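(* Let $G$ and $H$ be finitely generated groups with exponential growth. Then $G\times H$ (with respect to any finite symmetric generating set) does not have the $\{f(n)\}$-retainment property for any function $f:\{1,2,\dots\}\to\{0,1,2,\dots\}$ with subexponential growth, i.e. satisfying $\lim_{n}\frac1n\log f(n)=0$.
   Context: For a finitely generated group $G$ with finite symmetric generating set $S$, consider its Cayley graph, with vertex set $G$ and edges $x\sim xs$, $s\in S$. Let $B_n$ be the ball of radius $n$ around the identity for the graph distance and $v_G(n)=|B_n|$. For functions write $a\preceq b$ if there is a constant $C>0$ with $a(n)\le C\,b(Cn)+C$ for all $n$, and $a\simeq b$ (equivalent) if $a\preceq b$ and $b\preceq a$. $G$ has exponential growth if $v_G(n)\simeq\gamma^n$ for some $\gamma>1$. Fire process on a Cayley graph $\Gamma$: a fire breaks out at time $0$ on a finite set $F_0$ of vertices. At each time $n\ge 1$ a set $W_n$ of at most $f(n)$ vertices not on fire ($W_n\cap F_{n-1}=\emptyset$) is declared protected forever, and then $F_n=F_{n-1}\cup\{x : x\sim y \text{ for some } y\in F_{n-1},\ x\notin W_1\cup\dots\cup W_n\}$. Such a sequence $\{W_n\}$ is an $\{f(n)\}$-allowed strategy. Let $U=\Gamma\setminus\bigcup_n F_n$. $\Gamma$ has the $\{f(n)\}$-retainment property if for every finite $F_0$ there is an $\{f(n)\}$-allowed strategy such that $n\mapsto|U\cap B_n|$ is equivalent to $v_\Gamma$. *)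

theory Defs
  imports Complex_Main "HOL-Library.Extended_Nat" "HOL-Algebra.Generated_Groups"
begin

definition symmetric_generating_set :: "('a, 'm) monoid_scheme \<Rightarrow> 'a set \<Rightarrow> bool" where
  "symmetric_generating_set G S \<longleftrightarrow>
     finite S \<and> S \<subseteq> carrier G \<and> (\<forall>s\<in>S. inv\<^bsub>G\<^esub> s \<in> S) \<and> generate G S = carrier G"

definition finitely_generated :: "('a, 'm) monoid_scheme \<Rightarrow> bool" where
  "finitely_generated G \<longleftrightarrow> (\<exists>S. finite S \<and> S \<subseteq> carrier G \<and> generate G S = carrier G)"

definition cayley_edges :: "('a, 'm) monoid_scheme \<Rightarrow> 'a set \<Rightarrow> ('a \<times> 'a) set" where
  "cayley_edges G S = {(x, x \<otimes>\<^bsub>G\<^esub> s) | x s. x \<in> carrier G \<and> s \<in> S}"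

text \<open>Edge relations are symmetric here, so the relation power \<open>E ^^ k\<close> consists of the pairs
  joined by a walk with \<open>k\<close> edges. The infimum over the empty set is \<open>\<infinity>\<close>.\<close>

definition graph_dist :: "('a \<times> 'a) set \<Rightarrow> 'a \<Rightarrow> 'a \<Rightarrow> enat" where
  "graph_dist E x y = (INF k\<in>{k. (x, y) \<in> E ^^ k}. enat k)"

definition cayley_ball :: "('a, 'm) monoid_scheme \<Rightarrow> 'a set \<Rightarrow> nat \<Rightarrow> 'a set" where
  "cayley_ball G S n =
     {x \<in> carrier G. graph_dist (cayley_edges G S) \<one>\<^bsub>G\<^esub> x \<le> enat n}"

definition volume_growth :: "('a, 'm) monoid_scheme \<Rightarrow> 'a set \<Rightarrow> nat \<Rightarrow> real" where
  "volume_growth G S n = real (card (cayley_ball G S n))"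

text \<open>The functions compared below are nonnegative and nondecreasing, so taking the constant to be
  a natural number, which makes \<open>C * n\<close> a legitimate argument, loses no generality.\<close>

definition growth_le :: "(nat \<Rightarrow> real) \<Rightarrow> (nat \<Rightarrow> real) \<Rightarrow> bool" where
  "growth_le a b \<longleftrightarrow> (\<exists>C::nat. C > 0 \<and> (\<forall>n. a n \<le> real C * b (C * n) + real C))"

definition growth_equiv :: "(nat \<Rightarrow> real) \<Rightarrow> (nat \<Rightarrow> real) \<Rightarrow> bool" where
  "growth_equiv a b \<longleftrightarrow> growth_le a b \<and> growth_le b a"

text \<open>The equivalence class of the volume growth does not depend on the finite symmetric generating
  set, so one may equivalently quantify over it existentially or universally.\<close>

definition exponential_growth :: "('a, 'm) monoid_scheme \<Rightarrow> bool" where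
  "exponential_growth G \<longleftrightarrow>
     (\<exists>S. symmetric_generating_set G S \<and>
          (\<exists>\<gamma>::real. \<gamma> > 1 \<and> growth_equiv (volume_growth G S) (\<lambda>n. \<gamma> ^ n)))"

text \<open>Only \<open>W n\<close> and \<open>f n\<close> with \<open>n \<ge> 1\<close> matter below.\<close>

primrec burning :: "('a \<times> 'a) set \<Rightarrow> 'a set \<Rightarrow> (nat \<Rightarrow> 'a set) \<Rightarrow> nat \<Rightarrow> 'a set" where
  "burning E F0 W 0 = F0"
| "burning E F0 W (Suc n) = burning E F0 W n \<union>
     {x. (\<exists>y \<in> burning E F0 W n. (x, y) \<in> E) \<and> x \<notin> (\<Union>i\<in>{1..Suc n}. W i)}"

definition allowed_strategy ::
  "('a, 'm) monoid_scheme \<Rightarrow> 'a set \<Rightarrow> (nat \<Rightarrow> nat) \<Rightarrow> 'a set \<Rightarrow> (nat \<Rightarrow> 'a set) \<Rightarrow> bool" where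
  "allowed_strategy G S f F0 W \<longleftrightarrow>
     (\<forall>n\<ge>1. W n \<subseteq> carrier G \<and> finite (W n) \<and> card (W n) \<le> f n \<and>
            W n \<inter> burning (cayley_edges G S) F0 W (n - 1) = {})"

definition unburned ::
  "('a, 'm) monoid_scheme \<Rightarrow> 'a set \<Rightarrow> 'a set \<Rightarrow> (nat \<Rightarrow> 'a set) \<Rightarrow> 'a set" where
  "unburned G S F0 W = carrier G - (\<Union>n. burning (cayley_edges G S) F0 W n)"

definition retainment_property ::
  "('a, 'm) monoid_scheme \<Rightarrow> 'a set \<Rightarrow> (nat \<Rightarrow> nat) \<Rightarrow> bool" where
  "retainment_property G S f \<longleftrightarrow>
     (\<forall>F0. finite F0 \<and> F0 \<subseteq> carrier G \<longrightarrow>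
        (\<exists>W. allowed_strategy G S f F0 W \<and>
             growth_equiv (\<lambda>n. real (card (unburned G S F0 W \<inter> cayley_ball G S n)))
                          (volume_growth G S)))"

text \<open>Since \<open>ln 0 = 0\<close>, zero values of \<open>f\<close> do not affect the limit. Every \<open>f\<close> for which the limit is
  \<open>0\<close> with the convention \<open>log 0 = -\<infinity>\<close> satisfies this condition; in addition \<open>f\<close> may vanish
  infinitely often.\<close>

definition subexponential :: "(nat \<Rightarrow> nat) \<Rightarrow> bool" where
  "subexponential f \<longleftrightarrow> (\<lambda>n. ln (real (f n)) / real n) \<longlonglongrightarrow> 0"

end

theory Submission
  imports Defs
begin

text \<open>
  A vertex burns as soon as one walk reaches it from the initial fire without stepping onto a vertex
  that is protected by then. With subexponentially many protected vertices it therefore suffices to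
  have a random walk whose position after \<open>i\<close> steps hits any given vertex only with
  probability exponentially small in \<open>i\<close>. To aim at a prescribed target \<open>(g, h)\<close>
  without concentrating on the way, the walk detours through both factors:
  \<open>(1, 1) \<rightarrow> (a, 1) \<rightarrow> (a, h b) \<rightarrow> (g, h b) \<rightarrow> (g, h)\<close>,
  where \<open>a\<close> and \<open>b\<close> range over balls of radius at most \<open>N\<close>, a small multiple of
  the distance to the target. On the second leg the first coordinate \<open>a\<close> is spread over
  exponentially many values and on the third leg the second coordinate \<open>h b\<close> is, so most
  choices avoid the protected vertices altogether. On the first leg the walk must spread fast: the
  radius is chosen such that the balls inside it are exponentially smaller (\<open>well_spread_radius\<close>),
  whence few endpoints \<open>a\<close> have their walk hit early obstacles (\<open>spread_walk_avoiding\<close>), and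
  the first few steps, where nothing has spread yet, lie inside the initial fire. The last leg stays
  within distance \<open>N\<close> of the target, so it can only fail for targets that are near a
  protected vertex.

  Consequently every unburned vertex within distance \<open>M\<close> of the identity is near one of
  \<open>e\<^sup>o\<^sup>(\<^sup>M\<^sup>)\<close> protected vertices (\<open>fire_reaches_product\<close>), and there are at most
  \<open>e\<^sup>o\<^sup>(\<^sup>M\<^sup>) D\<^sup>N\<close> of them (\<open>card_unburned_product_le\<close>), where
  \<open>D\<^sup>N\<close> bounds the size of a ball of radius \<open>N\<close> in \<open>H\<close>. Taking
  \<open>N = \<epsilon> M\<close> with \<open>\<epsilon>\<close> small makes the growth rate of the unburned set smaller
  than any given exponential rate, contradicting retainment.
\<close>

section \<open>Balls and walks in Cayley graphs\<close>

context group
begin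

lemma cayley_edges_walk_carrier:
  assumes "S \<subseteq> carrier G" "x \<in> carrier G" "(x, y) \<in> cayley_edges G S ^^ k"
  shows "y \<in> carrier G"
  using assms(3)
proof (induction k arbitrary: y)
  case 0
  then show ?case using assms by simp
next
  case (Suc k)
  then show ?case using assms(1) by (auto simp: cayley_edges_def)
qed

text \<open>Together with \<open>cayley_ball_0\<close> and \<open>cayley_ball_Suc\<close> this replaces the metric
  description of balls by a recursive one. There the identity joins the generators so that a ball
  is exactly the set of products of a fixed number of factors.\<close>

lemma cayley_ball_iff:
  assumes "S \<subseteq> carrier G"
  shows "x \<in> cayley_ball G S n \<longleftrightarrow> (\<exists>k\<le>n. (\<one>, x) \<in> cayley_edges G S ^^ k)"
proof
  assume "x \<in> cayley_ball G S n"
  then have le: "(INF k\<in>{k. (\<one>, x) \<in> cayley_edges G S ^^ k}. enat k) < enat (Suc n)"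
    unfolding cayley_ball_def graph_dist_def by (auto intro: le_less_trans)
  then show "\<exists>k\<le>n. (\<one>, x) \<in> cayley_edges G S ^^ k"
    unfolding INF_less_iff by (auto simp: less_Suc_eq_le)
next
  assume "\<exists>k\<le>n. (\<one>, x) \<in> cayley_edges G S ^^ k"
  then obtain k where k: "k \<le> n" "(\<one>, x) \<in> cayley_edges G S ^^ k" by blast
  have "(INF k\<in>{k. (\<one>, x) \<in> cayley_edges G S ^^ k}. enat k) \<le> enat k"
    by (rule INF_lower) (use k in simp)
  also have "\<dots> \<le> enat n" using k by simp
  finally show "x \<in> cayley_ball G S n"
    using cayley_edges_walk_carrier[OF assms one_closed k(2)]
    unfolding cayley_ball_def graph_dist_def by simp
qed

lemma cayley_ball_0:
  assumes "S \<subseteq> carrier G"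
  shows "cayley_ball G S 0 = {\<one>}"
  using assms by (auto simp: cayley_ball_iff)

lemma cayley_ball_carrier: "cayley_ball G S n \<subseteq> carrier G"
  by (auto simp: cayley_ball_def)

lemma in_cayley_ball_carrier: "x \<in> cayley_ball G S n \<Longrightarrow> x \<in> carrier G"
  by (auto simp: cayley_ball_def)

lemma cayley_ball_mono: "m \<le> n \<Longrightarrow> cayley_ball G S m \<subseteq> cayley_ball G S n"
  by (auto simp: cayley_ball_def elim: order_trans)

lemma cayley_ball_Suc:
  assumes "S \<subseteq> carrier G"
  shows "cayley_ball G S (Suc n) = (\<lambda>(y, s). y \<otimes> s) ` (cayley_ball G S n \<times> insert \<one> S)"
proof (intro equalityI subsetI)
  fix x assume x: "x \<in> cayley_ball G S (Suc n)"
  then obtain k where k: "k \<le> Suc n" "(\<one>, x) \<in> cayley_edges G S ^^ k"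
    using assms by (auto simp: cayley_ball_iff)
  have xc: "x \<in> carrier G" using x cayley_ball_carrier by blast
  show "x \<in> (\<lambda>(y, s). y \<otimes> s) ` (cayley_ball G S n \<times> insert \<one> S)"
  proof (cases k)
    case 0
    then have "x \<in> cayley_ball G S n" using k assms by (auto simp: cayley_ball_iff intro: exI[of _ 0])
    then show ?thesis using xc by (intro image_eqI[of _ _ "(x, \<one>)"]) auto
  next
    case (Suc j)
    then obtain y where y: "(\<one>, y) \<in> cayley_edges G S ^^ j" "(y, x) \<in> cayley_edges G S"
      using k by auto
    then have "y \<in> cayley_ball G S n" using assms k Suc by (auto simp: cayley_ball_iff)
    then show ?thesis using y(2) by (auto simp: cayley_edges_def image_iff)
  qed
next
  fix x assume "x \<in> (\<lambda>(y, s). y \<otimes> s) ` (cayley_ball G S n \<times> insert \<one> S)"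
  then obtain y s where ys: "y \<in> cayley_ball G S n" "s \<in> insert \<one> S" "x = y \<otimes> s" by auto
  have yc: "y \<in> carrier G" using ys cayley_ball_carrier by blast
  obtain k where k: "k \<le> n" "(\<one>, y) \<in> cayley_edges G S ^^ k"
    using ys assms by (auto simp: cayley_ball_iff)
  show "x \<in> cayley_ball G S (Suc n)"
  proof (cases "s = \<one>")
    case True
    then show ?thesis using ys yc cayley_ball_mono[of n "Suc n" S] by auto
  next
    case False
    then have "(y, x) \<in> cayley_edges G S" using ys yc by (auto simp: cayley_edges_def)
    then have "(\<one>, x) \<in> cayley_edges G S ^^ Suc k" using k by auto
    then show ?thesis using assms k by (subst cayley_ball_iff) (auto intro!: exI[of _ "Suc k"])
  qed
qed

lemma one_in_cayley_ball: "S \<subseteq> carrier G \<Longrightarrow> \<one> \<in> cayley_ball G S n"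
  using cayley_ball_mono[of 0 n S] cayley_ball_0 by auto

lemma cayley_ball_finite:
  assumes "S \<subseteq> carrier G" "finite S"
  shows "finite (cayley_ball G S n)"
  by (induction n) (use assms in \<open>auto simp: cayley_ball_0 cayley_ball_Suc\<close>)

lemma card_cayley_ball_pos:
  assumes "S \<subseteq> carrier G" "finite S"
  shows "card (cayley_ball G S n) > 0"
  using assms cayley_ball_finite one_in_cayley_ball by (metis card_gt_0_iff empty_iff)

lemma card_cayley_ball_le:
  assumes "S \<subseteq> carrier G" "finite S"
  shows "card (cayley_ball G S n) \<le> card (insert \<one> S) ^ n"
proof (induction n)
  case 0
  then show ?case using assms by (simp add: cayley_ball_0)
next
  case (Suc n)
  have "card (cayley_ball G S (Suc n)) \<le> card (cayley_ball G S n \<times> insert \<one> S)"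
    unfolding cayley_ball_Suc[OF assms(1)]
    by (rule card_image_le) (use assms cayley_ball_finite in auto)
  also have "\<dots> = card (cayley_ball G S n) * card (insert \<one> S)"
    by (rule card_cartesian_product)
  also have "\<dots> \<le> card (insert \<one> S) ^ n * card (insert \<one> S)"
    using Suc by simp
  finally show ?case by (simp add: mult.commute)
qed

lemma cayley_ball_mult:
  assumes "S \<subseteq> carrier G" "x \<in> cayley_ball G S m" "y \<in> cayley_ball G S n"
  shows "x \<otimes> y \<in> cayley_ball G S (m + n)"
  using assms(3)
proof (induction n arbitrary: y)
  case 0
  then show ?case using assms cayley_ball_carrier[of S m] by (auto simp: cayley_ball_0)
next
  case (Suc n)
  then obtain z s where z: "z \<in> cayley_ball G S n" "s \<in> insert \<one> S" "y = z \<otimes> s"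
    using assms by (auto simp: cayley_ball_Suc)
  have car: "x \<in> carrier G" "z \<in> carrier G" "s \<in> carrier G"
    using assms z in_cayley_ball_carrier by auto
  have "x \<otimes> y = (x \<otimes> z) \<otimes> s" using z car by (simp add: m_assoc)
  moreover have "x \<otimes> z \<in> cayley_ball G S (m + n)" by (rule Suc.IH) fact
  ultimately show ?case using assms(1) z by (simp add: cayley_ball_Suc image_iff) blast
qed

lemma generator_in_cayley_ball:
  assumes "S \<subseteq> carrier G" "s \<in> insert \<one> S"
  shows "s \<in> cayley_ball G S 1"
  using assms by (auto simp: cayley_ball_Suc cayley_ball_0 image_iff intro!: bexI[of _ s])

lemma cayley_ball_inv:
  assumes "S \<subseteq> carrier G" "\<And>s. s \<in> S \<Longrightarrow> inv s \<in> S" "x \<in> cayley_ball G S n"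
  shows "inv x \<in> cayley_ball G S n"
  using assms(3)
proof (induction n arbitrary: x)
  case 0
  then show ?case using assms by (auto simp: cayley_ball_0)
next
  case (Suc n)
  then obtain z s where z: "z \<in> cayley_ball G S n" "s \<in> insert \<one> S" "x = z \<otimes> s"
    using assms by (auto simp: cayley_ball_Suc)
  have car: "z \<in> carrier G" "s \<in> carrier G"
    using assms z in_cayley_ball_carrier by auto
  have "inv x = inv s \<otimes> inv z" using z car by (simp add: inv_mult_group)
  moreover have "inv s \<in> cayley_ball G S 1"
    by (rule generator_in_cayley_ball[OF assms(1)]) (use assms(2) z in auto)
  ultimately show ?case
    using cayley_ball_mult[OF assms(1), of "inv s" 1 "inv z" n] Suc.IH[OF z(1)] by simp
qed

lemma finite_subset_cayley_ball:
  assumes "symmetric_generating_set G S" "finite X" "X \<subseteq> carrier G"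
  shows "\<exists>n. X \<subseteq> cayley_ball G S n"
proof -
  have S: "S \<subseteq> carrier G" "generate G S = carrier G" and sym: "\<And>s. s \<in> S \<Longrightarrow> inv s \<in> S"
    using assms by (auto simp: symmetric_generating_set_def)
  have point: "\<exists>n. x \<in> cayley_ball G S n" if "x \<in> generate G S" for x
    using that
  proof induction
    case one
    then show ?case using one_in_cayley_ball S by blast
  next
    case (incl s)
    then show ?case using generator_in_cayley_ball[OF S(1)] by blast
  next
    case (inv s)
    then show ?case using generator_in_cayley_ball[OF S(1)] sym by blast
  next
    case (eng x y)
    then show ?case using cayley_ball_mult[OF S(1)] by blast
  qed
  show ?thesis
    using assms(2,3)
  proof induction
    case empty
    then show ?case by simp
  next
    case (insert x X)
    then obtain n where "X \<subseteq> cayley_ball G S n" by auto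
    moreover obtain m where "x \<in> cayley_ball G S m" using point[of x] insert S by auto
    ultimately have "insert x X \<subseteq> cayley_ball G S (max m n)"
      using cayley_ball_mono[of m "max m n" S] cayley_ball_mono[of n "max m n" S] by auto
    then show ?case by blast
  qed
qed

end

text \<open>Allowing the walk to rest makes every element of a ball of radius \<open>n\<close> reachable in
  exactly \<open>n\<close> steps, so that all walks compared later have equal length.\<close>

definition lazy_walk :: "('a, 'm) monoid_scheme \<Rightarrow> 'a set \<Rightarrow> nat \<Rightarrow> (nat \<Rightarrow> 'a) \<Rightarrow> bool" where
  "lazy_walk G S n w \<longleftrightarrow>
     w 0 \<in> carrier G \<and> (\<forall>i<n. \<exists>s\<in>insert \<one>\<^bsub>G\<^esub> S. w (Suc i) = w i \<otimes>\<^bsub>G\<^esub> s)"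

context group
begin

lemma lazy_walk_carrier:
  assumes "S \<subseteq> carrier G" "lazy_walk G S n w" "i \<le> n"
  shows "w i \<in> carrier G"
  using assms(3)
proof (induction i)
  case 0
  then show ?case using assms by (simp add: lazy_walk_def)
next
  case (Suc i)
  then obtain s where "s \<in> insert \<one> S" "w (Suc i) = w i \<otimes> s"
    using assms(2) unfolding lazy_walk_def by (metis Suc_le_lessD)
  then show ?case using Suc assms(1) by auto
qed

lemma lazy_walk_exists:
  assumes "S \<subseteq> carrier G" "x \<in> carrier G" "y \<in> cayley_ball G S n"
  shows "\<exists>w. lazy_walk G S n w \<and> w 0 = x \<and> w n = x \<otimes> y"
  using assms(3)
proof (induction n arbitrary: y)
  case 0
  then show ?case using assms
    by (intro exI[of _ "\<lambda>_. x"]) (auto simp: cayley_ball_0 lazy_walk_def)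
next
  case (Suc n)
  then obtain z s where z: "z \<in> cayley_ball G S n" "s \<in> insert \<one> S" "y = z \<otimes> s"
    using assms by (auto simp: cayley_ball_Suc)
  have car: "z \<in> carrier G" "s \<in> carrier G"
    using assms z in_cayley_ball_carrier by auto
  obtain w where w: "lazy_walk G S n w" "w 0 = x" "w n = x \<otimes> z" using Suc.IH[OF z(1)] by blast
  have "lazy_walk G S (Suc n) (w(Suc n := x \<otimes> y))"
    unfolding lazy_walk_def
  proof (intro conjI allI impI)
    show "(w(Suc n := x \<otimes> y)) 0 \<in> carrier G" using w assms(2) by simp
    fix i assume i: "i < Suc n"
    show "\<exists>s\<in>insert \<one> S. (w(Suc n := x \<otimes> y)) (Suc i) = (w(Suc n := x \<otimes> y)) i \<otimes> s"
    proof (cases "i = n")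
      case True
      have "x \<otimes> y = w n \<otimes> s" using w z car assms(2) by (simp add: m_assoc)
      then show ?thesis using True z(2) by (intro bexI[of _ s]) simp_all
    next
      case False
      then show ?thesis using w(1) i by (simp add: lazy_walk_def)
    qed
  qed
  moreover have "(w(Suc n := x \<otimes> y)) 0 = x" "(w(Suc n := x \<otimes> y)) (Suc n) = x \<otimes> y"
    using w by simp_all
  ultimately show ?case by blast
qed

text \<open>This limits how many endpoints a walk can still have once its position at time
  \<open>i\<close> is known, and it locates each position near the endpoint.\<close>

lemma lazy_walk_remaining:
  assumes "S \<subseteq> carrier G" "lazy_walk G S n w" "i \<le> n"
  shows "\<exists>y\<in>cayley_ball G S (n - i). w n = w i \<otimes> y"
  using assms(3)
proof (induction i rule: inc_induct)
  case base
  then show ?case using assms lazy_walk_carrier[OF assms(1,2), of n] by (auto simp: cayley_ball_0)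
next
  case (step i)
  then obtain y where y: "y \<in> cayley_ball G S (n - Suc i)" "w n = w (Suc i) \<otimes> y" by blast
  obtain s where s: "s \<in> insert \<one> S" "w (Suc i) = w i \<otimes> s"
    using assms(2) step unfolding lazy_walk_def by blast
  have car: "w i \<in> carrier G" "s \<in> carrier G" "y \<in> carrier G"
    using lazy_walk_carrier[OF assms(1,2), of i] s y assms(1) step in_cayley_ball_carrier by auto
  have "s \<otimes> y \<in> cayley_ball G S (1 + (n - Suc i))"
    by (rule cayley_ball_mult[OF assms(1) generator_in_cayley_ball[OF assms(1) s(1)] y(1)])
  moreover have "1 + (n - Suc i) = n - i" using step by simp
  ultimately show ?case using y s car by (intro bexI[of _ "s \<otimes> y"]) (auto simp: m_assoc)
qed

lemma lazy_walk_from_one_in_ball: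
  assumes "S \<subseteq> carrier G" "lazy_walk G S n w" "w 0 = \<one>" "i \<le> n"
  shows "w i \<in> cayley_ball G S i"
proof -
  have "lazy_walk G S i w" using assms(2,4) by (auto simp: lazy_walk_def)
  then obtain y where "y \<in> cayley_ball G S i" "w i = w 0 \<otimes> y"
    using lazy_walk_remaining[OF assms(1), of i w 0] by auto
  then show ?thesis using assms(3) in_cayley_ball_carrier by simp
qed

end

section \<open>How fire follows a walk\<close>

text \<open>The walks to be followed use generators of the two factors, each of which is a product of at
  most \<open>L\<close> generators from \<open>S\<close>. One step therefore takes the fire \<open>L\<close> time units and
  passes through vertices within distance \<open>L\<close> of its endpoint. Thickening the protected sets
  by \<open>L\<close> makes it enough to control the endpoints of the steps.\<close>

definition blocked ::
  "('a, 'm) monoid_scheme \<Rightarrow> 'a set \<Rightarrow> nat \<Rightarrow> (nat \<Rightarrow> 'a set) \<Rightarrow> nat \<Rightarrow> 'a set" where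
  "blocked G S L W m =
     (\<lambda>(w, y). w \<otimes>\<^bsub>G\<^esub> y) ` ((\<Union>j\<in>{1..L * m}. W j) \<times> cayley_ball G S L)"

lemma blocked_mono: "m \<le> n \<Longrightarrow> blocked G S L W m \<subseteq> blocked G S L W n"
  unfolding blocked_def by (intro image_mono Sigma_mono UN_mono) auto

lemma burning_mono: "m \<le> n \<Longrightarrow> burning E F0 W m \<subseteq> burning E F0 W n"
  by (rule lift_Suc_mono_le[of "burning E F0 W"]) auto

context group
begin

lemma burning_lazy_walk_step:
  assumes "S \<subseteq> carrier G" "\<And>s. s \<in> S \<Longrightarrow> inv s \<in> S"
    and walk: "lazy_walk G S n q" and start: "q 0 \<in> burning (cayley_edges G S) F0 W m"
    and free: "\<And>i j. \<lbrakk>i \<in> {1..n}; j \<in> {1..m + n}\<rbrakk> \<Longrightarrow> q i \<notin> W j"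
    and "i \<le> n"
  shows "q i \<in> burning (cayley_edges G S) F0 W (m + i)"
  using \<open>i \<le> n\<close>
proof (induction i)
  case 0
  then show ?case using start by simp
next
  case (Suc i)
  obtain s where s: "s \<in> insert \<one> S" "q (Suc i) = q i \<otimes> s"
    using walk Suc unfolding lazy_walk_def by (metis Suc_le_lessD)
  have car: "q i \<in> carrier G" "s \<in> carrier G"
    using lazy_walk_carrier[OF assms(1) walk, of i] Suc s assms(1) by auto
  have IH: "q i \<in> burning (cayley_edges G S) F0 W (m + i)" using Suc by simp
  show ?case
  proof (cases "s = \<one>")
    case True
    then show ?thesis using s car IH by simp
  next
    case False
    have "q i = q (Suc i) \<otimes> inv s" using s car by (simp add: m_assoc)
    then have "(q (Suc i), q i) \<in> cayley_edges G S"
      using False s car assms(2) by (auto simp: cayley_edges_def)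
    then show ?thesis using IH free[of "Suc i"] Suc.prems by auto
  qed
qed

text \<open>A vertex of \<open>F0\<close> burns at all times, so it does no harm if the walk visits blocked
  vertices there. This is what makes a large initial fire useful.\<close>

lemma fire_follows_walk:
  assumes S: "S \<subseteq> carrier G" "\<And>s. s \<in> S \<Longrightarrow> inv s \<in> S" and T: "T \<subseteq> cayley_ball G S L"
    and walk: "lazy_walk G T n q" and start: "q 0 \<in> burning (cayley_edges G S) F0 W (L * m)"
    and free: "\<And>i. i \<in> {1..n} \<Longrightarrow> q i \<in> F0 \<or> q i \<notin> blocked G S L W (m + i)"
  shows "q n \<in> burning (cayley_edges G S) F0 W (L * (m + n))"
proof -
  have Tc: "T \<subseteq> carrier G" using T cayley_ball_carrier by blast
  have "q i \<in> burning (cayley_edges G S) F0 W (L * (m + i))" if "i \<le> n" for i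
    using that
  proof (induction i)
    case 0
    then show ?case using start by simp
  next
    case (Suc i)
    have IH: "q i \<in> burning (cayley_edges G S) F0 W (L * (m + i))" using Suc by simp
    show ?case
    proof (cases "q (Suc i) \<in> F0")
      case True
      then show ?thesis using burning_mono[of 0 "L * (m + Suc i)" "cayley_edges G S" F0 W] by auto
    next
      case False
      then have nb: "q (Suc i) \<notin> blocked G S L W (m + Suc i)" using free[of "Suc i"] Suc by auto
      obtain t where t: "t \<in> insert \<one> T" "q (Suc i) = q i \<otimes> t"
        using walk Suc unfolding lazy_walk_def by (metis Suc_le_lessD)
      have "t \<in> cayley_ball G S L" using t T one_in_cayley_ball[OF S(1)] by auto
      moreover have "q i \<in> carrier G" using lazy_walk_carrier[OF Tc walk, of i] Suc by simp
      ultimately obtain w where w: "lazy_walk G S L w" "w 0 = q i" "w L = q i \<otimes> t"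
        using lazy_walk_exists[OF S(1)] by blast
      \<comment> \<open>A protected vertex on the way would put the endpoint of the step into the blocked set.\<close>
      have avoid: "w j \<notin> W l" if j: "j \<in> {1..L}" and l: "l \<in> {1..L * (m + i) + L}" for j l
      proof
        assume "w j \<in> W l"
        moreover obtain y where y: "y \<in> cayley_ball G S (L - j)" "w L = w j \<otimes> y"
          using lazy_walk_remaining[OF S(1) w(1), of j] j by auto
        moreover have "y \<in> cayley_ball G S L" using y cayley_ball_mono[of "L - j" L S] by auto
        moreover have "l \<in> {1..L * (m + Suc i)}" using l by (simp add: algebra_simps)
        ultimately have "w j \<otimes> y \<in> blocked G S L W (m + Suc i)"
          unfolding blocked_def by (intro image_eqI[of _ _ "(w j, y)"]) auto
        then show False using nb t w y by simp
      qed
      have "w L \<in> burning (cayley_edges G S) F0 W (L * (m + i) + L)"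
        by (rule burning_lazy_walk_step[OF S w(1)]) (use IH w avoid in auto)
      then show ?thesis using w t by (simp add: algebra_simps)
    qed
  qed
  then show ?thesis by blast
qed

lemma card_blocked_le:
  assumes "S \<subseteq> carrier G" "finite S" and "\<And>j. j \<ge> 1 \<Longrightarrow> finite (W j) \<and> card (W j) \<le> f j"
  shows "finite (blocked G S L W m)"
    "card (blocked G S L W m) \<le> card (cayley_ball G S L) * (\<Sum>j\<in>{1..L * m}. f j)"
proof -
  have fin: "finite (\<Union>j\<in>{1..L * m}. W j)" "finite (cayley_ball G S L)"
    using assms cayley_ball_finite by auto
  then show "finite (blocked G S L W m)" unfolding blocked_def by auto
  have "card (blocked G S L W m) \<le> card (\<Union>j\<in>{1..L * m}. W j) * card (cayley_ball G S L)"
    unfolding blocked_def card_cartesian_product[symmetric] by (rule card_image_le) (use fin in auto)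
  also have "card (\<Union>j\<in>{1..L * m}. W j) \<le> (\<Sum>j\<in>{1..L * m}. card (W j))"
    by (rule card_UN_le) simp
  also have "\<dots> \<le> (\<Sum>j\<in>{1..L * m}. f j)" by (rule sum_mono) (use assms in auto)
  finally show "card (blocked G S L W m) \<le> card (cayley_ball G S L) * (\<Sum>j\<in>{1..L * m}. f j)"
    by (simp add: mult.commute)
qed

end

text \<open>One statement serves for the two projections of a direct product and for the embedding of a
  factor, which relate the balls of the product to those of the factors.\<close>

lemma (in group_hom) cayley_ball_hom:
  assumes "S \<subseteq> carrier G" "T \<subseteq> carrier H" "h ` S \<subseteq> cayley_ball H T L"
    and "x \<in> cayley_ball G S n"
  shows "h x \<in> cayley_ball H T (L * n)"
  using assms(4)
proof (induction n arbitrary: x)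
  case 0
  then show ?case using assms by (simp add: G.cayley_ball_0 H.cayley_ball_0)
next
  case (Suc n)
  then obtain z s where z: "z \<in> cayley_ball G S n" "s \<in> insert \<one> S" "x = z \<otimes> s"
    using assms by (auto simp: G.cayley_ball_Suc)
  have car: "z \<in> carrier G" "s \<in> carrier G"
    using assms z G.in_cayley_ball_carrier by auto
  have "h s \<in> cayley_ball H T L"
    using z assms H.one_in_cayley_ball[OF assms(2), of L] by auto
  then have "h z \<otimes>\<^bsub>H\<^esub> h s \<in> cayley_ball H T (L * n + L)"
    by (rule H.cayley_ball_mult[OF assms(2) Suc.IH[OF z(1)]])
  then show ?case using z car by (simp add: algebra_simps)
qed

section \<open>Exponential and subexponential growth\<close>

text \<open>Equivalence of growth rescales the radius by a factor \<open>C\<close>, so the base drops from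
  \<open>\<gamma>\<close> to its \<open>C\<close>-th root. Since balls are never empty, the additive constant can be
  absorbed into the multiplicative one.\<close>

lemma exponential_growth_lower_bound:
  assumes "group G" "exponential_growth G"
  obtains S c \<beta> where "symmetric_generating_set G S" "c > 0" "\<beta> > (1::real)"
    "\<And>n. c * \<beta> ^ n \<le> real (card (cayley_ball G S n))"
proof -
  interpret group G by fact
  obtain S \<gamma> where S: "symmetric_generating_set G S" and "\<gamma> > 1"
    and "growth_le (\<lambda>n. \<gamma> ^ n) (volume_growth G S)"
    using assms(2) unfolding exponential_growth_def growth_equiv_def by blast
  then obtain C :: nat where C: "C > 0" "\<And>n. \<gamma> ^ n \<le> real C * volume_growth G S (C * n) + real C"
    unfolding growth_le_def by blast
  define \<beta> where "\<beta> = root C \<gamma>"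
  have \<beta>: "\<beta> > 1" "\<beta> ^ C = \<gamma>" using C \<open>\<gamma> > 1\<close> by (auto simp: \<beta>_def)
  have "1 / (2 * C * \<gamma>) * \<beta> ^ n \<le> real (card (cayley_ball G S n))" for n
  proof -
    have fin: "S \<subseteq> carrier G" "finite S" using S by (auto simp: symmetric_generating_set_def)
    define b where "b = real (card (cayley_ball G S n))"
    have "b \<ge> 1" unfolding b_def using card_cayley_ball_pos[OF fin, of n] by linarith
    have "volume_growth G S (C * (n div C)) \<le> b"
      unfolding volume_growth_def b_def of_nat_le_iff
      by (intro card_mono cayley_ball_finite cayley_ball_mono fin) simp
    then have "real C * volume_growth G S (C * (n div C)) \<le> real C * b"
      by (rule mult_left_mono) simp
    then have "\<gamma> ^ (n div C) \<le> real C * b + real C"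
      using C(2)[of "n div C"] by linarith
    also have "\<dots> \<le> 2 * C * b" using \<open>b \<ge> 1\<close> C(1) by simp
    finally have bound: "\<gamma> ^ (n div C) \<le> 2 * C * b" .
    have "n \<le> C * (n div C) + C"
      using mult_div_mod_eq[of C n] mod_less_divisor[OF C(1), of n] by linarith
    then have "\<beta> ^ n \<le> \<beta> ^ (C * (n div C) + C)"
      using \<beta> by (intro power_increasing) auto
    also have "\<dots> = \<gamma> ^ (n div C) * \<gamma>" using \<beta> by (simp add: power_add power_mult)
    also have "\<dots> \<le> 2 * C * b * \<gamma>" using bound \<open>\<gamma> > 1\<close> by simp
    finally show ?thesis using C \<open>\<gamma> > 1\<close> by (simp add: b_def field_simps)
  qed
  moreover have "1 / (2 * C * \<gamma>) > 0" using C \<open>\<gamma> > 1\<close> by simp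
  ultimately show ?thesis using that S \<beta>(1) by blast
qed

lemma subexponential_le_power:
  assumes "subexponential f" "\<theta> > (1::real)"
  obtains C where "C \<ge> 0" "\<And>j. j \<ge> 1 \<Longrightarrow> real (f j) \<le> C * \<theta> ^ j"
proof -
  have "eventually (\<lambda>j. ln (real (f j)) / real j < ln \<theta>) sequentially"
    using assms unfolding subexponential_def by (intro order_tendstoD(2)) auto
  then obtain J where J: "\<And>j. j \<ge> J \<Longrightarrow> ln (real (f j)) / real j < ln \<theta>"
    by (auto simp: eventually_sequentially)
  have "real (f j) \<le> (1 + (\<Sum>i<J. real (f i))) * \<theta> ^ j" if "j \<ge> 1" for j
  proof (cases "j < J")
    case True
    then have "real (f j) \<le> (\<Sum>i<J. real (f i))" by (intro member_le_sum) auto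
    also have "\<dots> \<le> (1 + (\<Sum>i<J. real (f i))) * 1" by simp
    also have "\<dots> \<le> (1 + (\<Sum>i<J. real (f i))) * \<theta> ^ j"
      using assms by (intro mult_left_mono) (auto simp: sum_nonneg add_nonneg_nonneg)
    finally show ?thesis .
  next
    case False
    have "real (f j) \<le> \<theta> ^ j"
    proof (cases "f j = 0")
      case True
      then show ?thesis using assms by simp
    next
      case False
      have "ln (real (f j)) < ln (\<theta> ^ j)"
        using J[of j] \<open>\<not> j < J\<close> that assms by (simp add: field_simps ln_realpow)
      then show ?thesis using False assms by simp
    qed
    moreover have "(\<Sum>i<J. real (f i)) * \<theta> ^ j \<ge> 0" using assms by (simp add: sum_nonneg)
    ultimately show ?thesis by (simp add: distrib_right)
  qed
  then show ?thesis using that by (metis add_nonneg_nonneg of_nat_0_le_iff sum_nonneg zero_le_one)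
qed

lemma subexponential_sum_le_power:
  assumes "subexponential f" "\<eta> > (1::real)"
  obtains C where "C \<ge> 0" "\<And>m. (\<Sum>j\<in>{1..L * m}. real (f j)) \<le> C * \<eta> ^ m"
proof -
  define \<theta> where "\<theta> = root (Suc L) \<eta>"
  have \<theta>: "\<theta> > 1" "\<theta> ^ Suc L = \<eta>"
    using assms real_root_pow_pos[of "Suc L" \<eta>] by (auto simp: \<theta>_def simp del: power_Suc)
  have "\<theta> ^ L \<le> \<eta>" using \<theta> power_increasing[of L "Suc L" \<theta>] by simp
  obtain C where C: "C \<ge> 0" "\<And>j. j \<ge> 1 \<Longrightarrow> real (f j) \<le> C * \<theta> ^ j"
    using subexponential_le_power[OF assms(1) \<theta>(1)] by blast
  define D where "D = C * \<theta> / (\<theta> - 1)"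
  have D: "D \<ge> 0" "D * \<theta> = D + C * \<theta>" using C \<theta> by (auto simp: D_def field_simps)
  have geometric: "(\<Sum>j\<in>{1..n}. real (f j)) \<le> D * \<theta> ^ n" for n
  proof (induction n)
    case 0
    then show ?case using D by simp
  next
    case (Suc n)
    have "(\<Sum>j\<in>{1..Suc n}. real (f j)) \<le> D * \<theta> ^ n + C * \<theta> ^ Suc n"
      using Suc C(2)[of "Suc n"] by simp
    also have "\<dots> = (D + C * \<theta>) * \<theta> ^ n" by (simp add: algebra_simps)
    also have "\<dots> = D * \<theta> ^ Suc n" unfolding D(2)[symmetric] by simp
    finally show ?case .
  qed
  have "(\<Sum>j\<in>{1..L * m}. real (f j)) \<le> D * \<eta> ^ m" for m
  proof -
    have "(\<theta> ^ L) ^ m \<le> \<eta> ^ m" using \<open>\<theta> ^ L \<le> \<eta>\<close> \<theta> by (intro power_mono) auto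
    then show ?thesis using geometric[of "L * m"] D(1)
      by (metis mult_left_mono order_trans power_mult)
  qed
  then show ?thesis using that D by blast
qed

lemma exponential_dominates:
  assumes "0 < \<rho>" "\<rho> < (\<theta>::real)" "c > 0"
  shows "eventually (\<lambda>n. C * \<rho> ^ n < c * \<theta> ^ n) sequentially"
proof -
  have "(\<lambda>n. C * (\<rho> / \<theta>) ^ n) \<longlonglongrightarrow> C * 0"
    by (intro tendsto_mult tendsto_const LIMSEQ_realpow_zero) (use assms in auto)
  then have "eventually (\<lambda>n. C * (\<rho> / \<theta>) ^ n < c) sequentially"
    using assms(3) by (intro order_tendstoD(2)) auto
  then show ?thesis
    by eventually_elim (use assms in \<open>simp add: power_divide field_simps\<close>)
qed

lemma summable_tail_le:
  assumes "summable (g :: nat \<Rightarrow> real)" "e > 0"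
  obtains R where "\<And>k. (\<Sum>i\<in>{R<..k}. g i) \<le> e"
proof -
  obtain R where R: "\<And>m n. m \<ge> R \<Longrightarrow> norm (sum g {m..<n}) < e"
    using assms unfolding summable_Cauchy by blast
  have "(\<Sum>i\<in>{R<..k}. g i) \<le> e" for k
  proof -
    have "{R<..k} = {Suc R..<Suc k}" by auto
    then show ?thesis using R[of "Suc R" "Suc k"] by auto
  qed
  then show ?thesis using that by blast
qed

text \<open>An exponential lower bound on \<open>b\<close> does not make \<open>b (k - i)\<close> exponentially smaller
  than \<open>b k\<close> for every \<open>k\<close>. It does so for a \<open>k \<le> N\<close> that maximises \<open>b k / \<mu> ^ k\<close>, and as
  \<open>b\<close> grows at rate \<open>\<mu>\<^sup>2\<close>, faster than \<open>\<mu>\<close>, the value at such a \<open>k\<close> is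
  still exponentially large in \<open>N\<close>.\<close>

lemma well_spread_radius:
  fixes b :: "nat \<Rightarrow> real"
  assumes "\<mu> > 1" "c > 0" "\<And>n. c * (\<mu>\<^sup>2) ^ n \<le> b n"
  obtains k where "k \<le> N" "c * \<mu> ^ N \<le> b k" "\<And>i. i \<le> k \<Longrightarrow> b (k - i) \<le> b k / \<mu> ^ i"
proof -
  have "Max ((\<lambda>j. b j / \<mu> ^ j) ` {..N}) \<in> (\<lambda>j. b j / \<mu> ^ j) ` {..N}" by (rule Max_in) auto
  then obtain k where "k \<in> {..N}" and k': "Max ((\<lambda>j. b j / \<mu> ^ j) ` {..N}) = b k / \<mu> ^ k"
    by (rule imageE)
  then have k: "k \<le> N" by simp
  have max: "b j / \<mu> ^ j \<le> b k / \<mu> ^ k" if "j \<le> N" for j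
    unfolding k'[symmetric] by (rule Max_ge) (use that in auto)
  have "0 < c * (\<mu>\<^sup>2) ^ k" using assms by simp
  then have "b k \<ge> 0" using assms(3)[of k] by linarith
  show ?thesis
  proof (rule that[OF k])
    have "c * \<mu> ^ N = c * (\<mu>\<^sup>2) ^ N / \<mu> ^ N"
      using assms by (simp add: power2_eq_square power_mult_distrib)
    also have "\<dots> \<le> b N / \<mu> ^ N" using assms by (intro divide_right_mono) auto
    also have "\<dots> \<le> b k / \<mu> ^ k" using max by simp
    also have "\<dots> \<le> b k / 1" using assms \<open>b k \<ge> 0\<close> by (intro divide_left_mono) auto
    finally show "c * \<mu> ^ N \<le> b k" by simp
  next
    fix i assume i: "i \<le> k"
    have "b (k - i) \<le> b k / \<mu> ^ k * \<mu> ^ (k - i)"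
      using max[of "k - i"] k assms by (simp add: field_simps)
    also have "\<dots> = b k / \<mu> ^ i" using i assms by (simp add: power_diff)
    finally show "b (k - i) \<le> b k / \<mu> ^ i" .
  qed
qed

section \<open>Walks avoiding small sets\<close>

context group
begin

text \<open>Fix a walk to each endpoint of the ball. A vertex met at time \<open>i\<close> spoils at most as many
  endpoints as the ball of radius \<open>k - i\<close> has elements, hence at most a fraction
  \<open>1 / \<mu> ^ i\<close> of all. So the obstacles \<open>V i\<close> spoil at most half of the endpoints and
  the set \<open>X\<close> less than the other half.\<close>

lemma spread_walk_avoiding:
  fixes V :: "nat \<Rightarrow> 'a set"
  assumes S: "S \<subseteq> carrier G" "finite S"
    and spread: "\<And>i. i \<le> k \<Longrightarrow>
      real (card (cayley_ball G S (k - i))) \<le> real (card (cayley_ball G S k)) / \<mu> ^ i"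
    and V: "\<And>i. finite (V i)" "(\<Sum>i\<in>{R<..k}. real (card (V i)) / \<mu> ^ i) \<le> 1 / 2"
    and X: "finite X" "2 * card X < card (cayley_ball G S k)"
  obtains w where "lazy_walk G S k w" "w 0 = \<one>" "w k \<notin> X" "\<And>i. i \<in> {R<..k} \<Longrightarrow> w i \<notin> V i"
proof -
  let ?b = "\<lambda>i. card (cayley_ball G S i)"
  \<comment> \<open>The endpoints spoiled by the obstacles at time \<open>i\<close>.\<close>
  define P where "P i = (\<lambda>(v, y). v \<otimes> y) ` (V i \<times> cayley_ball G S (k - i))" for i
  define Y where "Y = X \<union> (\<Union>i\<in>{R<..k}. P i)"
  have fin: "finite (P i)" for i
    unfolding P_def using V(1) cayley_ball_finite[OF S] by auto
  have P: "real (card (P i)) \<le> real (?b k) * (real (card (V i)) / \<mu> ^ i)" if "i \<le> k" for i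
  proof -
    have "card (P i) \<le> card (V i) * ?b (k - i)"
      unfolding P_def card_cartesian_product[symmetric]
      by (rule card_image_le) (use V(1) cayley_ball_finite[OF S] in auto)
    then have "real (card (P i)) \<le> real (card (V i)) * real (?b (k - i))"
      by (metis of_nat_le_iff of_nat_mult)
    also have "\<dots> \<le> real (card (V i)) * (real (?b k) / \<mu> ^ i)"
      by (rule mult_left_mono[OF spread[OF that]]) simp
    finally show ?thesis by (simp add: mult.commute)
  qed
  have "card Y \<le> card X + card (\<Union>i\<in>{R<..k}. P i)"
    unfolding Y_def by (rule card_Un_le)
  also have "\<dots> \<le> card X + (\<Sum>i\<in>{R<..k}. card (P i))"
    by (intro add_left_mono card_UN_le) simp
  finally have "real (card Y) \<le> real (card X) + (\<Sum>i\<in>{R<..k}. real (card (P i)))"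
    by (metis of_nat_le_iff of_nat_add of_nat_sum)
  also have "(\<Sum>i\<in>{R<..k}. real (card (P i))) \<le> (\<Sum>i\<in>{R<..k}. real (?b k) * (real (card (V i)) / \<mu> ^ i))"
    by (rule sum_mono) (use P in auto)
  also have "\<dots> = real (?b k) * (\<Sum>i\<in>{R<..k}. real (card (V i)) / \<mu> ^ i)"
    by (rule sum_distrib_left[symmetric])
  also have "\<dots> \<le> real (?b k) * (1 / 2)" by (rule mult_left_mono[OF V(2)]) simp
  finally have "card Y < ?b k" using X by linarith
  moreover have "finite Y" unfolding Y_def using X fin by auto
  ultimately have "\<not> cayley_ball G S k \<subseteq> Y" by (meson card_mono not_le)
  then obtain a where a: "a \<in> cayley_ball G S k" "a \<notin> Y" by auto
  obtain w where w: "lazy_walk G S k w" "w 0 = \<one>" "w k = a"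
    using lazy_walk_exists[OF S(1) one_closed a(1)] in_cayley_ball_carrier[OF a(1)] by auto
  show ?thesis
  proof (rule that[OF w(1,2)])
    show "w k \<notin> X" using w a by (auto simp: Y_def)
    fix i assume i: "i \<in> {R<..k}"
    show "w i \<notin> V i"
    proof
      assume "w i \<in> V i"
      moreover obtain y where "y \<in> cayley_ball G S (k - i)" "a = w i \<otimes> y"
        using lazy_walk_remaining[OF S(1) w(1), of i] i w by auto
      ultimately have "a \<in> P i" unfolding P_def by auto
      then show False using a i by (auto simp: Y_def)
    qed
  qed
qed

lemma translate_ball_avoiding:
  assumes "S \<subseteq> carrier G" "\<And>s. s \<in> S \<Longrightarrow> inv s \<in> S" "h \<in> carrier G"
    and "finite X" "card X < card (cayley_ball G S N)"
  obtains b where "b \<in> cayley_ball G S N" "h \<otimes> b \<notin> X"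
proof -
  have "inj_on ((\<otimes>) h) (cayley_ball G S N)"
    by (rule inj_onI) (use assms(3) in_cayley_ball_carrier in auto)
  then have "\<not> (\<otimes>) h ` cayley_ball G S N \<subseteq> X"
    using card_inj_on_le[of "(\<otimes>) h" "cayley_ball G S N" X] assms by auto
  then show ?thesis using that by auto
qed

end

section \<open>Fire in a direct product\<close>

lemma lazy_walk_DirProd_fst:
  assumes "group H" "lazy_walk G A n w" "h \<in> carrier H"
  shows "lazy_walk (G \<times>\<times> H) (A \<times> {\<one>\<^bsub>H\<^esub>} \<union> {\<one>\<^bsub>G\<^esub>} \<times> B) n (\<lambda>i. (w i, h))"
proof -
  interpret H: group H by fact
  have "\<exists>s\<in>insert \<one>\<^bsub>G \<times>\<times> H\<^esub> (A \<times> {\<one>\<^bsub>H\<^esub>} \<union> {\<one>\<^bsub>G\<^esub>} \<times> B).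
      (w (Suc i), h) = (w i, h) \<otimes>\<^bsub>G \<times>\<times> H\<^esub> s" if i: "i < n" for i
  proof -
    obtain s where "s \<in> insert \<one>\<^bsub>G\<^esub> A" "w (Suc i) = w i \<otimes>\<^bsub>G\<^esub> s"
      using assms(2) i by (auto simp: lazy_walk_def)
    then show ?thesis using assms(3) by (intro bexI[of _ "(s, \<one>\<^bsub>H\<^esub>)"]) auto
  qed
  then show ?thesis using assms by (auto simp: lazy_walk_def)
qed

lemma lazy_walk_DirProd_snd:
  assumes "group G" "lazy_walk H B n w" "g \<in> carrier G"
  shows "lazy_walk (G \<times>\<times> H) (A \<times> {\<one>\<^bsub>H\<^esub>} \<union> {\<one>\<^bsub>G\<^esub>} \<times> B) n (\<lambda>i. (g, w i))"
proof -
  interpret G: group G by fact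
  have "\<exists>s\<in>insert \<one>\<^bsub>G \<times>\<times> H\<^esub> (A \<times> {\<one>\<^bsub>H\<^esub>} \<union> {\<one>\<^bsub>G\<^esub>} \<times> B).
      (g, w (Suc i)) = (g, w i) \<otimes>\<^bsub>G \<times>\<times> H\<^esub> s" if i: "i < n" for i
  proof -
    obtain s where "s \<in> insert \<one>\<^bsub>H\<^esub> B" "w (Suc i) = w i \<otimes>\<^bsub>H\<^esub> s"
      using assms(2) i by (auto simp: lazy_walk_def)
    then show ?thesis using assms(3) by (intro bexI[of _ "(\<one>\<^bsub>G\<^esub>, s)"]) auto
  qed
  then show ?thesis using assms by (auto simp: lazy_walk_def)
qed

text \<open>The four legs described at the beginning, with \<open>k \<le> N\<close> the radius over which
  \<open>a\<close> ranges, take \<open>k + (M + N) + (k + M) + N \<le> 2 M + 4 N\<close> steps in total. Only the first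
  leg looks at the blocked sets at the time of passing; afterwards the choice of \<open>a\<close>, the choice
  of \<open>b\<close>, and the assumption \<open>far\<close> on the target avoid everything blocked up to the very
  end. A blocked set is avoided on the second leg by keeping \<open>a\<close> off its projection to
  \<open>G\<close>, and on the third by keeping \<open>h b\<close> off its projection to \<open>H\<close>, whatever the
  remaining coordinate does.\<close>

lemma fire_reaches_product:
  fixes G :: "('a, 'm) monoid_scheme" and H :: "('b, 'k) monoid_scheme"
  defines "\<Gamma> \<equiv> G \<times>\<times> H"
  assumes "group G" "group H"
    and A: "A \<subseteq> carrier G" "finite A" "\<And>s. s \<in> A \<Longrightarrow> inv\<^bsub>G\<^esub> s \<in> A"
    and B: "B \<subseteq> carrier H" "\<And>s. s \<in> B \<Longrightarrow> inv\<^bsub>H\<^esub> s \<in> B"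
    and S: "S \<subseteq> carrier \<Gamma>" "\<And>s. s \<in> S \<Longrightarrow> inv\<^bsub>\<Gamma>\<^esub> s \<in> S"
    and AB: "A \<times> {\<one>\<^bsub>H\<^esub>} \<union> {\<one>\<^bsub>G\<^esub>} \<times> B \<subseteq> cayley_ball \<Gamma> S L"
    and fin: "\<And>m. finite (blocked \<Gamma> S L W m)"
    and "\<mu> > 1" and k: "k \<le> N" "\<And>i. i \<le> k \<Longrightarrow>
      real (card (cayley_ball G A (k - i))) \<le> real (card (cayley_ball G A k)) / \<mu> ^ i"
    and early: "(\<Sum>i\<in>{R<..k}. real (card (blocked \<Gamma> S L W i)) / \<mu> ^ i) \<le> 1 / 2"
    and fewG: "2 * card (blocked \<Gamma> S L W (2 * M + 4 * N)) < card (cayley_ball G A k)"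
    and fewH: "card (blocked \<Gamma> S L W (2 * M + 4 * N)) < card (cayley_ball H B N)"
    and g: "g \<in> cayley_ball G A M" and h: "h \<in> cayley_ball H B M"
    and far: "\<And>b. b \<in> cayley_ball H B N \<Longrightarrow>
      (g, h \<otimes>\<^bsub>H\<^esub> b) \<notin> blocked \<Gamma> S L W (2 * M + 4 * N)"
  shows "(g, h) \<in> burning (cayley_edges \<Gamma> S) (cayley_ball G A R \<times> {\<one>\<^bsub>H\<^esub>}) W (L * (2 * M + 4 * N))"
proof -
  interpret G: group G by fact
  interpret H: group H by fact
  interpret P: group \<Gamma> unfolding \<Gamma>_def by (rule DirProd_group) fact+
  let ?T = "A \<times> {\<one>\<^bsub>H\<^esub>} \<union> {\<one>\<^bsub>G\<^esub>} \<times> B"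
  let ?F = "cayley_ball G A R \<times> {\<one>\<^bsub>H\<^esub>}"
  let ?burn = "\<lambda>m. burning (cayley_edges \<Gamma> S) ?F W (L * m)"
  let ?Q = "blocked \<Gamma> S L W"
  define Q where "Q = ?Q (2 * M + 4 * N)"
  have finQ: "finite Q" unfolding Q_def by (rule fin)
  have gc: "g \<in> carrier G" and hc: "h \<in> carrier H"
    using g h G.in_cayley_ball_carrier H.in_cayley_ball_carrier by auto
  have leg: "q n \<in> ?burn (m + n)"
    if "lazy_walk \<Gamma> ?T n q" "q 0 \<in> ?burn m" "m + n \<le> 2 * M + 4 * N" "\<And>i. i \<le> n \<Longrightarrow> q i \<notin> Q"
    for q n m
  proof (rule P.fire_follows_walk[OF S AB that(1,2)])
    fix i assume "i \<in> {1..n}"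
    then show "q i \<in> ?F \<or> q i \<notin> ?Q (m + i)"
      using that(4)[of i] blocked_mono[of "m + i" "2 * M + 4 * N" \<Gamma> S L W] that(3)
      by (auto simp: Q_def)
  qed
  have cardfst: "card (fst ` Q) \<le> card Q" and cardsnd: "card (snd ` Q) \<le> card Q"
    using finQ by (auto intro: card_image_le)

  have inj: "inj_on (\<lambda>x. (x, \<one>\<^bsub>H\<^esub>)) X" for X :: "'a set" by (auto intro: inj_onI)
  let ?V = "\<lambda>i. (\<lambda>x. (x, \<one>\<^bsub>H\<^esub>)) -` ?Q i"
  have finV: "finite (?V i)" and cardV: "card (?V i) \<le> card (?Q i)" for i
    using inj[of UNIV] fin[of i] by (auto intro: finite_vimageI card_vimage_inj_on_le[of _ UNIV, simplified])
  have "(\<Sum>i\<in>{R<..k}. real (card (?V i)) / \<mu> ^ i) \<le> 1 / 2"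
  proof (rule order_trans[OF sum_mono early])
    show "real (card (?V i)) / \<mu> ^ i \<le> real (card (?Q i)) / \<mu> ^ i" for i
      using cardV[of i] \<open>\<mu> > 1\<close> by (intro divide_right_mono) auto
  qed
  then obtain w where w: "lazy_walk G A k w" "w 0 = \<one>\<^bsub>G\<^esub>" "w k \<notin> fst ` Q"
    "\<And>i. i \<in> {R<..k} \<Longrightarrow> w i \<notin> ?V i"
    using G.spread_walk_avoiding[OF A(1,2) k(2), of ?V R "fst ` Q"] finV finQ fewG cardfst
    by (auto simp: Q_def)
  define a where "a = w k"
  have ac: "a \<in> carrier G" and aB: "a \<in> cayley_ball G A k"
    using G.lazy_walk_carrier[OF A(1) w(1)] G.lazy_walk_from_one_in_ball[OF A(1) w(1,2), of k]
    by (auto simp: a_def)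
  have "card (snd ` Q) < card (cayley_ball H B N)" using cardsnd fewH by (simp add: Q_def)
  then obtain b where b: "b \<in> cayley_ball H B N" "h \<otimes>\<^bsub>H\<^esub> b \<notin> snd ` Q"
    using H.translate_ball_avoiding[OF B(1,2) hc, of "snd ` Q"] finQ by blast
  have bc: "b \<in> carrier H" using b H.in_cayley_ball_carrier by auto

  have leg1: "(a, \<one>\<^bsub>H\<^esub>) \<in> ?burn (0 + k)"
  proof -
    have "(w k, \<one>\<^bsub>H\<^esub>) \<in> ?burn (0 + k)"
    proof (rule P.fire_follows_walk[OF S AB])
      show "lazy_walk \<Gamma> ?T k (\<lambda>i. (w i, \<one>\<^bsub>H\<^esub>))"
        unfolding \<Gamma>_def by (rule lazy_walk_DirProd_fst[OF \<open>group H\<close> w(1)]) simp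
      show "(w 0, \<one>\<^bsub>H\<^esub>) \<in> ?burn 0" using w G.one_in_cayley_ball[OF A(1)] by simp
      fix i assume i: "i \<in> {1..k}"
      show "(w i, \<one>\<^bsub>H\<^esub>) \<in> ?F \<or> (w i, \<one>\<^bsub>H\<^esub>) \<notin> ?Q (0 + i)"
      proof (cases "i \<le> R")
        case True
        then have "w i \<in> cayley_ball G A R"
          using G.lazy_walk_from_one_in_ball[OF A(1) w(1,2), of i] i G.cayley_ball_mono[of i R A] by auto
        then show ?thesis by simp
      next
        case False
        then show ?thesis using w(4)[of i] i by auto
      qed
    qed
    then show ?thesis by (simp add: a_def)
  qed

  have hb: "h \<otimes>\<^bsub>H\<^esub> b \<in> cayley_ball H B (M + N)" by (rule H.cayley_ball_mult[OF B(1) h b(1)])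
  obtain u where u: "lazy_walk H B (M + N) u" "u 0 = \<one>\<^bsub>H\<^esub>" "u (M + N) = h \<otimes>\<^bsub>H\<^esub> b"
    using H.lazy_walk_exists[OF B(1) H.one_closed hb] hc bc by auto
  have leg2: "(a, h \<otimes>\<^bsub>H\<^esub> b) \<in> ?burn (k + (M + N))"
  proof -
    have "(a, u (M + N)) \<in> ?burn (k + (M + N))"
    proof (rule leg)
      show "lazy_walk \<Gamma> ?T (M + N) (\<lambda>i. (a, u i))"
        unfolding \<Gamma>_def by (rule lazy_walk_DirProd_snd[OF \<open>group G\<close> u(1) ac])
      show "(a, u 0) \<in> ?burn k" using leg1 u by simp
      show "k + (M + N) \<le> 2 * M + 4 * N" using k by simp
      show "(a, u i) \<notin> Q" for i using w(3) by (force simp: a_def)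
    qed
    then show ?thesis by (simp add: u)
  qed

  have ag: "inv\<^bsub>G\<^esub> a \<otimes>\<^bsub>G\<^esub> g \<in> cayley_ball G A (k + M)"
    by (rule G.cayley_ball_mult[OF A(1) G.cayley_ball_inv[OF A(1,3) aB] g])
  obtain v where v: "lazy_walk G A (k + M) v" "v 0 = a" "v (k + M) = g"
    using G.lazy_walk_exists[OF A(1) ac ag] ac gc by (auto simp flip: G.m_assoc)
  have leg3: "(g, h \<otimes>\<^bsub>H\<^esub> b) \<in> ?burn (k + (M + N) + (k + M))"
  proof -
    have "(v (k + M), h \<otimes>\<^bsub>H\<^esub> b) \<in> ?burn (k + (M + N) + (k + M))"
    proof (rule leg)
      show "lazy_walk \<Gamma> ?T (k + M) (\<lambda>i. (v i, h \<otimes>\<^bsub>H\<^esub> b))"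
        unfolding \<Gamma>_def by (rule lazy_walk_DirProd_fst[OF \<open>group H\<close> v(1)]) (use hc bc in simp)
      show "(v 0, h \<otimes>\<^bsub>H\<^esub> b) \<in> ?burn (k + (M + N))" using leg2 v by simp
      show "k + (M + N) + (k + M) \<le> 2 * M + 4 * N" using k by simp
      show "(v i, h \<otimes>\<^bsub>H\<^esub> b) \<notin> Q" for i using b(2) by force
    qed
    then show ?thesis by (simp add: v)
  qed

  obtain z where z: "lazy_walk H B N z" "z 0 = h \<otimes>\<^bsub>H\<^esub> b" "z N = h \<otimes>\<^bsub>H\<^esub> b \<otimes>\<^bsub>H\<^esub> inv\<^bsub>H\<^esub> b"
    using H.lazy_walk_exists[OF B(1) _ H.cayley_ball_inv[OF B(1,2) b(1)], of "h \<otimes>\<^bsub>H\<^esub> b"] hc bc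
    by auto
  have zN: "z N = h" using z hc bc by (simp add: H.m_assoc)
  have "(g, z N) \<in> ?burn (k + (M + N) + (k + M) + N)"
  proof (rule leg)
    show "lazy_walk \<Gamma> ?T N (\<lambda>i. (g, z i))"
      unfolding \<Gamma>_def by (rule lazy_walk_DirProd_snd[OF \<open>group G\<close> z(1) gc])
    show "(g, z 0) \<in> ?burn (k + (M + N) + (k + M))" using leg3 z by simp
    show "k + (M + N) + (k + M) + N \<le> 2 * M + 4 * N" using k by simp
    fix i assume "i \<le> N"
    then obtain y where y: "y \<in> cayley_ball H B (N - i)" "h = z i \<otimes>\<^bsub>H\<^esub> y"
      using H.lazy_walk_remaining[OF B(1) z(1)] zN by auto
    have car: "y \<in> carrier H" "z i \<in> carrier H"
      using y H.in_cayley_ball_carrier H.lazy_walk_carrier[OF B(1) z(1) \<open>i \<le> N\<close>] by auto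
    have "inv\<^bsub>H\<^esub> y \<in> cayley_ball H B N"
      using H.cayley_ball_inv[OF B(1,2) y(1)] H.cayley_ball_mono[of "N - i" N B] by auto
    moreover have "z i = h \<otimes>\<^bsub>H\<^esub> inv\<^bsub>H\<^esub> y" using y(2) car by (simp add: H.m_assoc)
    ultimately show "(g, z i) \<notin> Q" using far by (simp add: Q_def)
  qed
  then have "(g, h) \<in> ?burn (k + (M + N) + (k + M) + N)" by (simp add: zN)
  moreover have "L * (k + (M + N) + (k + M) + N) \<le> L * (2 * M + 4 * N)"
    using k by (intro mult_left_mono) auto
  ultimately show ?thesis by (rule subsetD[OF burning_mono, rotated])
qed

text \<open>By \<open>fire_reaches_product\<close> each unburned vertex in range is a blocked one translated
  by an element of a ball of \<open>H\<close>.\<close>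

lemma card_unburned_product_le:
  fixes G :: "('a, 'm) monoid_scheme" and H :: "('b, 'k) monoid_scheme"
  defines "\<Gamma> \<equiv> G \<times>\<times> H"
  assumes "group G" "group H"
    and A: "A \<subseteq> carrier G" "finite A" "\<And>s. s \<in> A \<Longrightarrow> inv\<^bsub>G\<^esub> s \<in> A"
    and B: "B \<subseteq> carrier H" "finite B" "\<And>s. s \<in> B \<Longrightarrow> inv\<^bsub>H\<^esub> s \<in> B"
    and S: "S \<subseteq> carrier \<Gamma>" "\<And>s. s \<in> S \<Longrightarrow> inv\<^bsub>\<Gamma>\<^esub> s \<in> S"
    and AB: "A \<times> {\<one>\<^bsub>H\<^esub>} \<union> {\<one>\<^bsub>G\<^esub>} \<times> B \<subseteq> cayley_ball \<Gamma> S L"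
    and fin: "\<And>m. finite (blocked \<Gamma> S L W m)"
    and "\<mu> > 1" and k: "k \<le> N" "\<And>i. i \<le> k \<Longrightarrow>
      real (card (cayley_ball G A (k - i))) \<le> real (card (cayley_ball G A k)) / \<mu> ^ i"
    and early: "(\<Sum>i\<in>{R<..k}. real (card (blocked \<Gamma> S L W i)) / \<mu> ^ i) \<le> 1 / 2"
    and fewG: "2 * card (blocked \<Gamma> S L W (2 * M + 4 * N)) < card (cayley_ball G A k)"
    and fewH: "card (blocked \<Gamma> S L W (2 * M + 4 * N)) < card (cayley_ball H B N)"
    and X: "X \<subseteq> unburned \<Gamma> S (cayley_ball G A R \<times> {\<one>\<^bsub>H\<^esub>}) W"
      "X \<subseteq> cayley_ball G A M \<times> cayley_ball H B M"
  shows "card X \<le> card (blocked \<Gamma> S L W (2 * M + 4 * N)) * card (cayley_ball H B N)"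
proof -
  interpret H: group H by fact
  let ?Q = "blocked \<Gamma> S L W (2 * M + 4 * N)"
  let ?tr = "\<lambda>((g, h), b). (g, h \<otimes>\<^bsub>H\<^esub> inv\<^bsub>H\<^esub> b)"
  have "X \<subseteq> ?tr ` (?Q \<times> cayley_ball H B N)"
  proof
    fix x assume x: "x \<in> X"
    obtain g h where gh: "x = (g, h)" by (cases x)
    have gB: "g \<in> cayley_ball G A M" and hB: "h \<in> cayley_ball H B M" using x X(2) gh by auto
    have "(g, h) \<notin> burning (cayley_edges \<Gamma> S) (cayley_ball G A R \<times> {\<one>\<^bsub>H\<^esub>}) W (L * (2 * M + 4 * N))"
      using x X(1) gh by (auto simp: unburned_def)
    then obtain b where b: "b \<in> cayley_ball H B N" "(g, h \<otimes>\<^bsub>H\<^esub> b) \<in> ?Q"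
      using fire_reaches_product[OF \<open>group G\<close> \<open>group H\<close> A B(1,3) S[unfolded \<Gamma>_def] AB[unfolded \<Gamma>_def]
          fin[unfolded \<Gamma>_def] \<open>\<mu> > 1\<close> k early[unfolded \<Gamma>_def] fewG[unfolded \<Gamma>_def]
          fewH[unfolded \<Gamma>_def] gB hB] unfolding \<Gamma>_def by blast
    have "h = h \<otimes>\<^bsub>H\<^esub> b \<otimes>\<^bsub>H\<^esub> inv\<^bsub>H\<^esub> b"
      using b(1) hB H.in_cayley_ball_carrier by (simp add: H.m_assoc)
    then show "x \<in> ?tr ` (?Q \<times> cayley_ball H B N)"
      using b gh by (intro image_eqI[of _ _ "((g, h \<otimes>\<^bsub>H\<^esub> b), b)"]) auto
  qed
  moreover have "finite (?Q \<times> cayley_ball H B N)"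
    using fin[of "2 * M + 4 * N"] H.cayley_ball_finite[OF B(1,2)] by auto
  ultimately show ?thesis
    unfolding card_cartesian_product[symmetric] by (rule surj_card_le[rotated])
qed

theorem theorem1p7:
  fixes G :: "('a, 'm) monoid_scheme" and H :: "('b, 'k) monoid_scheme"
    and S :: "('a \<times> 'b) set" and f :: "nat \<Rightarrow> nat"
  assumes "group G" and "finitely_generated G" and "exponential_growth G"
    and "group H" and "finitely_generated H" and "exponential_growth H"
    and "symmetric_generating_set (G \<times>\<times> H) S"
    and "subexponential f"
  shows "\<not> retainment_property (G \<times>\<times> H) S f"
proof
  assume retain: "retainment_property (G \<times>\<times> H) S f"
  define \<Gamma> where "\<Gamma> = G \<times>\<times> H"
  interpret G: group G by fact
  interpret H: group H by fact
  interpret P: group \<Gamma> unfolding \<Gamma>_def by (rule DirProd_group) fact+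

  obtain A cG \<alpha> where symA: "symmetric_generating_set G A" and cG: "cG > 0" and \<alpha>: "\<alpha> > (1::real)"
    and growA: "\<And>n. cG * \<alpha> ^ n \<le> real (card (cayley_ball G A n))"
    using exponential_growth_lower_bound[OF assms(1,3)] by metis
  obtain B cH \<beta> where symB: "symmetric_generating_set H B" and cH: "cH > 0" and \<beta>: "\<beta> > (1::real)"
    and growB: "\<And>n. cH * \<beta> ^ n \<le> real (card (cayley_ball H B n))"
    using exponential_growth_lower_bound[OF assms(4,6)] by metis
  have A: "A \<subseteq> carrier G" "finite A" "\<And>s. s \<in> A \<Longrightarrow> inv\<^bsub>G\<^esub> s \<in> A"
    and B: "B \<subseteq> carrier H" "finite B" "\<And>s. s \<in> B \<Longrightarrow> inv\<^bsub>H\<^esub> s \<in> B"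
    and S: "S \<subseteq> carrier \<Gamma>" "\<And>s. s \<in> S \<Longrightarrow> inv\<^bsub>\<Gamma>\<^esub> s \<in> S" and "finite S"
    and symS: "symmetric_generating_set \<Gamma> S"
    using symA symB assms(7) by (auto simp: symmetric_generating_set_def \<Gamma>_def)

  let ?T = "A \<times> {\<one>\<^bsub>H\<^esub>} \<union> {\<one>\<^bsub>G\<^esub>} \<times> B"
  obtain L where L: "?T \<subseteq> cayley_ball \<Gamma> S L"
    using P.finite_subset_cayley_ball[OF symS, of ?T] A(1,2) B(1,2) by (auto simp: \<Gamma>_def)
  obtain L1 where L1: "fst ` S \<subseteq> cayley_ball G A L1"
    using G.finite_subset_cayley_ball[OF symA, of "fst ` S"] \<open>finite S\<close> S(1) by (force simp: \<Gamma>_def)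
  obtain L2 where L2: "snd ` S \<subseteq> cayley_ball H B L2"
    using H.finite_subset_cayley_ball[OF symB, of "snd ` S"] \<open>finite S\<close> S(1) by (force simp: \<Gamma>_def)
  define L' where "L' = max L1 L2"
  have L': "fst ` S \<subseteq> cayley_ball G A L'" "snd ` S \<subseteq> cayley_ball H B L'"
    using L1 L2 G.cayley_ball_mono[of L1 L' A] H.cayley_ball_mono[of L2 L' B] by (auto simp: L'_def)
  interpret fst: group_hom \<Gamma> G fst
    by unfold_locales (auto simp: hom_def \<Gamma>_def)
  interpret snd: group_hom \<Gamma> H snd
    by unfold_locales (auto simp: hom_def \<Gamma>_def)
  interpret emb: group_hom G \<Gamma> "\<lambda>g. (g, \<one>\<^bsub>H\<^esub>)"
    by unfold_locales (auto simp: hom_def \<Gamma>_def)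
  have ballS: "cayley_ball \<Gamma> S n \<subseteq> cayley_ball G A (L' * n) \<times> cayley_ball H B (L' * n)" for n
    using fst.cayley_ball_hom[OF S(1) A(1) L'(1)] snd.cayley_ball_hom[OF S(1) B(1) L'(2)]
    by (auto simp: mem_Times_iff)
  have growS: "cG * \<alpha> ^ n \<le> volume_growth \<Gamma> S (L * n)" for n
  proof -
    have "(\<lambda>g. (g, \<one>\<^bsub>H\<^esub>)) ` cayley_ball G A n \<subseteq> cayley_ball \<Gamma> S (L * n)"
      using emb.cayley_ball_hom[OF A(1) S(1)] L by blast
    then have "card (cayley_ball G A n) \<le> card (cayley_ball \<Gamma> S (L * n))"
      using P.cayley_ball_finite[OF S(1) \<open>finite S\<close>]
      by (intro card_inj_on_le[of "\<lambda>g. (g, \<one>\<^bsub>H\<^esub>)"]) (auto intro: inj_onI)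
    then show ?thesis using growA[of n] unfolding volume_growth_def by linarith
  qed

  \<comment> \<open>Half of the exponential rate of \<open>G\<close> is spent on spreading, the rest keeps the ball large.\<close>
  define \<mu> where "\<mu> = sqrt \<alpha>"
  have \<mu>: "\<mu> > 1" "\<mu>\<^sup>2 = \<alpha>" using \<alpha> by (auto simp: \<mu>_def)
  define \<phi> where "\<phi> m = card (cayley_ball \<Gamma> S L) * (\<Sum>j\<in>{1..L * m}. f j)" for m
  have \<phi>: "\<exists>C\<ge>0. \<forall>m. real (\<phi> m) \<le> C * \<eta> ^ m" if \<eta>: "\<eta> > 1" for \<eta> :: real
  proof -
    obtain C where C: "C \<ge> 0" "\<And>m. (\<Sum>j\<in>{1..L * m}. real (f j)) \<le> C * \<eta> ^ m"
      using subexponential_sum_le_power[OF assms(8) \<eta>] by blast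
    have "real (\<phi> m) \<le> real (card (cayley_ball \<Gamma> S L)) * C * \<eta> ^ m" for m
    proof -
      have "real (\<phi> m) = real (card (cayley_ball \<Gamma> S L)) * (\<Sum>j\<in>{1..L * m}. real (f j))"
        by (simp add: \<phi>_def)
      also have "\<dots> \<le> real (card (cayley_ball \<Gamma> S L)) * (C * \<eta> ^ m)"
        by (intro mult_left_mono C) simp
      finally show ?thesis by (simp add: mult.assoc)
    qed
    then show ?thesis using C(1) by (intro exI[of _ "real (card (cayley_ball \<Gamma> S L)) * C"]) auto
  qed

  \<comment> \<open>The initial fire must be so large that the obstacles met after leaving it spoil at most half
    of the endpoints. Its radius may depend on \<open>f\<close>, but not on the strategy.\<close>
  obtain R where R: "\<And>k. (\<Sum>i\<in>{R<..k}. real (\<phi> i) / \<mu> ^ i) \<le> 1 / 2"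
  proof -
    have "sqrt \<mu> > 1" using \<mu> by simp
    then obtain C where C: "\<And>m. real (\<phi> m) \<le> C * sqrt \<mu> ^ m" using \<phi> by blast
    have "summable (\<lambda>i. real (\<phi> i) / \<mu> ^ i)"
    proof (rule summable_comparison_test'[of "\<lambda>i. C * (sqrt \<mu> / \<mu>) ^ i" 0])
      have "sqrt \<mu> < \<mu>" using \<mu>(1) by (simp add: real_less_lsqrt power2_eq_square)
      then show "summable (\<lambda>i. C * (sqrt \<mu> / \<mu>) ^ i)"
        using \<mu> by (intro summable_mult summable_geometric) auto
      fix i
      have "real (\<phi> i) / \<mu> ^ i \<le> C * sqrt \<mu> ^ i / \<mu> ^ i"
        using C \<mu> by (intro divide_right_mono) auto
      then show "norm (real (\<phi> i) / \<mu> ^ i) \<le> C * (sqrt \<mu> / \<mu>) ^ i"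
        using \<mu> by (simp add: power_divide)
    qed
    from summable_tail_le[OF this, of "1 / 2"] that show ?thesis by auto
  qed

  define F0 where "F0 = cayley_ball G A R \<times> {\<one>\<^bsub>H\<^esub>}"
  have "finite F0" "F0 \<subseteq> carrier \<Gamma>"
    using G.cayley_ball_finite[OF A(1,2)] G.in_cayley_ball_carrier by (auto simp: F0_def \<Gamma>_def)
  then obtain W where W: "allowed_strategy \<Gamma> S f F0 W"
    and "growth_le (volume_growth \<Gamma> S) (\<lambda>n. real (card (unburned \<Gamma> S F0 W \<inter> cayley_ball \<Gamma> S n)))"
    using retain unfolding retainment_property_def growth_equiv_def \<Gamma>_def[symmetric] by blast
  then obtain C :: nat where C: "C > 0" "\<And>n. volume_growth \<Gamma> S n \<le>
      real C * real (card (unburned \<Gamma> S F0 W \<inter> cayley_ball \<Gamma> S (C * n))) + real C"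
    unfolding growth_le_def by blast
  have Wj: "finite (W j) \<and> card (W j) \<le> f j" if "j \<ge> 1" for j
    using W that unfolding allowed_strategy_def by blast
  have blocked: "finite (blocked \<Gamma> S L W m)" "card (blocked \<Gamma> S L W m) \<le> \<phi> m" for m
    using P.card_blocked_le[where f = f and W = W, OF S(1) \<open>finite S\<close>] Wj by (simp_all add: \<phi>_def)

  define D where "D = real (card (insert \<one>\<^bsub>H\<^esub> B))"
  have "D \<ge> 1" using B(2) by (simp add: D_def Suc_le_eq card_gt_0_iff)
  \<comment> \<open>The radius of the detours is smaller by a factor proportional to \<open>K\<close> than the distance to the
    target; the volume in range then beats the balls of radius \<open>N\<close> in \<open>H\<close>.\<close>
  obtain K where K: "2 * D < \<alpha> ^ K" using real_arch_pow[OF \<alpha>] by blast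
  define \<kappa> where "\<kappa> = 2 * (L' * (C * (L * K))) + 4"
  \<comment> \<open>All times are at most \<open>\<kappa> N\<close>, so rate \<open>\<eta>\<close> in time is rate \<open>\<rho>\<close> in \<open>N\<close>.\<close>
  define \<rho> where "\<rho> = (1 + min \<mu> (min \<beta> 2)) / 2"
  have \<rho>: "1 < \<rho>" "\<rho> < \<mu>" "\<rho> < \<beta>" "\<rho> < 2" using \<mu>(1) \<beta> by (auto simp: \<rho>_def)
  define \<eta> where "\<eta> = root \<kappa> \<rho>"
  have \<eta>: "\<eta> > 1" "\<eta> ^ \<kappa> = \<rho>" using \<rho>(1) by (auto simp: \<eta>_def \<kappa>_def)
  obtain c where c: "c \<ge> 0" "\<And>m. real (\<phi> m) \<le> c * \<eta> ^ m" using \<phi>[OF \<eta>(1)] by blast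

  have "\<rho> * D \<le> 2 * D" using \<rho>(4) \<open>D \<ge> 1\<close> by (intro mult_right_mono) auto
  then have "\<rho> * D < \<alpha> ^ K" using K by linarith
  then have "\<forall>\<^sub>F N in sequentially. 2 * c * \<rho> ^ N < cG * \<mu> ^ N \<and> c * \<rho> ^ N < cH * \<beta> ^ N \<and>
      (C * c + C) * (\<rho> * D) ^ N < cG * (\<alpha> ^ K) ^ N"
    using \<rho> \<open>D \<ge> 1\<close> cG cH by (intro eventually_conj exponential_dominates) auto
  then obtain N where N: "2 * c * \<rho> ^ N < cG * \<mu> ^ N" "c * \<rho> ^ N < cH * \<beta> ^ N"
    "(C * c + C) * (\<rho> * D) ^ N < cG * (\<alpha> ^ K) ^ N"
    unfolding eventually_sequentially by blast

  define n where "n = C * (L * (K * N))"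
  define M where "M = L' * n"
  have "2 * M + 4 * N = \<kappa> * N" by (simp add: M_def n_def \<kappa>_def algebra_simps)
  then have few: "real (card (blocked \<Gamma> S L W (2 * M + 4 * N))) \<le> c * \<rho> ^ N"
    using blocked(2)[of "2 * M + 4 * N"] c(2)[of "2 * M + 4 * N"] \<eta>(2)
    by (simp add: power_mult)
  obtain k where k: "k \<le> N" "cG * \<mu> ^ N \<le> real (card (cayley_ball G A k))" "\<And>i. i \<le> k \<Longrightarrow>
      real (card (cayley_ball G A (k - i))) \<le> real (card (cayley_ball G A k)) / \<mu> ^ i"
    using well_spread_radius[OF \<mu>(1) cG, of "\<lambda>n. real (card (cayley_ball G A n))" N] growA \<mu>(2)
    by blast
  let ?U = "unburned \<Gamma> S F0 W \<inter> cayley_ball \<Gamma> S n"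
  have "card ?U \<le> card (blocked \<Gamma> S L W (2 * M + 4 * N)) * card (cayley_ball H B N)"
  proof (rule card_unburned_product_le[OF \<open>group G\<close> \<open>group H\<close> A B, folded \<Gamma>_def])
    show "(\<Sum>i\<in>{R<..k}. real (card (blocked \<Gamma> S L W i)) / \<mu> ^ i) \<le> 1 / 2"
    proof (rule order_trans[OF sum_mono R])
      show "real (card (blocked \<Gamma> S L W i)) / \<mu> ^ i \<le> real (\<phi> i) / \<mu> ^ i" for i
        using blocked(2)[of i] \<mu>(1) by (intro divide_right_mono) auto
    qed
    show "2 * card (blocked \<Gamma> S L W (2 * M + 4 * N)) < card (cayley_ball G A k)"
      using few N(1) k(2) by linarith
    show "card (blocked \<Gamma> S L W (2 * M + 4 * N)) < card (cayley_ball H B N)"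
      using few N(2) growB[of N] by linarith
    show "?U \<subseteq> cayley_ball G A M \<times> cayley_ball H B M" using ballS[of n] by (auto simp: M_def)
  qed (use S L blocked(1) \<mu>(1) k in \<open>auto simp: F0_def\<close>)
  then have "real (card ?U) \<le> real (card (blocked \<Gamma> S L W (2 * M + 4 * N))) * real (card (cayley_ball H B N))"
    by (metis of_nat_le_iff of_nat_mult)
  also have "\<dots> \<le> c * \<rho> ^ N * D ^ N"
  proof (rule mult_mono[OF few])
    show "real (card (cayley_ball H B N)) \<le> D ^ N"
      using H.card_cayley_ball_le[OF B(1,2), of N] unfolding D_def by (metis of_nat_le_iff of_nat_power)
  qed (use c(1) \<rho>(1) in auto)
  finally have U: "real (card ?U) \<le> c * (\<rho> * D) ^ N" by (simp add: power_mult_distrib mult.assoc)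
  have "1 \<le> \<rho> * D" using mult_mono[of 1 \<rho> 1 D] \<rho>(1) \<open>D \<ge> 1\<close> by simp
  then have one: "1 \<le> (\<rho> * D) ^ N" by simp
  have "cG * (\<alpha> ^ K) ^ N \<le> volume_growth \<Gamma> S (L * (K * N))"
    using growS[of "K * N"] by (simp add: power_mult)
  also have "\<dots> \<le> real C * real (card ?U) + real C" using C(2)[of "L * (K * N)"] by (simp add: n_def)
  also have "\<dots> \<le> real C * (c * (\<rho> * D) ^ N) + real C * (\<rho> * D) ^ N"
    using U one by (intro add_mono mult_left_mono) (auto simp: mult_le_cancel_left1)
  also have "\<dots> = (C * c + C) * (\<rho> * D) ^ N" by (simp add: algebra_simps)
  also have "\<dots> < cG * (\<alpha> ^ K) ^ N" by (rule N(3))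
  finally show False by simp
qed

end
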